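(* Let $N\ge 1$. Every strategy-indifferent game of best choice, given by a nonempty finite multiset $\mathcal{I}$ of permutations in $\mathfrak{S}_N$, is strategically equivalent to a game $\mathcal{I}'$ arising from some finite multiset $\mathcal{J}'$ of permutations in $\mathfrak{S}_{N-1}$ by the following construction: (1) let $\mathcal{J}$ be the multiset of permutations in $\mathfrak{S}_N$ obtained by appending $N$ to the end of each permutation in $\mathcal{J}'$; and (2) for each $\pi\in\mathcal{J}$ (with multiplicity) and each left-to-right maximum position $i$ of $\pi$, add to $\mathcal{I}'$ a new permutation $\widetilde{\pi}\in\mathfrak{S}_N$ such that $\widetilde{\pi}|_{[i]}=\pi|_{[i]}$ and $\widetilde{\pi}_i=N$ (any such choice of $\widetilde\pi$ is allowed). Moreover, every nonempty finite multiset $\mathcal{J}'$ of permutations in $\mathfrak{S}_{N-1}$ defines in this way a strategy-indifferent game of best choice.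
   Context: $\mathfrak{S}_N$ is the set of permutations of $\{1,\dots,N\}$ in one-line notation ($\mathfrak{S}_0$ consists of the empty permutation). The flattening of a sequence of $i$ distinct integers is the unique permutation of $\{1,\dots,i\}$ with the same relative order. For a permutation $\pi$, $\pi|_{[i]}$ denotes the flattening of $\pi_1,\dots,\pi_i$. Game of best choice defined by a multiset $\mathcal{I}$ of elements of $\mathfrak{S}_N$: $\pi\in\mathcal{I}$ is chosen uniformly at random (each element weighted by its multiplicity; $|\mathcal{I}|$ is the sum of the multiplicities), and $\pi|_{[1]},\pi|_{[2]},\dots$ are presented sequentially to the player, who may stop at one position. The player wins if they stop at position $i$ with $\pi_i=N$, and loses otherwise. A strategy is given by a strike set $A$ of prefixes: the player stops at the first $i$ for which $\pi|_{[i]}\in A$ (and loses if there is no such $i$). An entry $\pi_j$ is a left-to-right maximum if $\pi_i<\pi_j$ for all $i<j$; then $j$ is a left-to-right maximum position. A permutation in $\bigcup_{i=1}^N\mathfrak{S}_i$ is an eligible prefix if its last entry is a left-to-right maximum. The prefix tree $\mathcal{P}_N$ is the set of all eligible prefixes in $\bigcup_{i=1}^N\mathfrak{S}_i$, partially ordered by containment: $q$ contains $p$ if $q|_{[i]}=p$, where $i$ is the size of $p$. A maximal antichain in $\mathcal{P}_N$ is a subset $A\subseteq\mathcal{P}_N$ with no two distinct elements comparable and such that every element of $\mathcal{P}_N$ contains or is contained in some element of $A$. $\mathcal{I}$ is strategy-indifferent if every strike set that is a maximal antichain in $\mathcal{P}_N$ has the same probability of winning the game defined by $\mathcal{I}$.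 Two games $\mathcal{I},\mathcal{I}'$ (multisets of permutations in $\mathfrak{S}_N$) are strategically equivalent if every maximal antichain $A\subseteq\mathcal{P}_N$ has the same probability of winning for $\mathcal{I}$ as for $\mathcal{I}'$. *)

theory Defs
  imports
    "HOL-Probability.Probability"
    "HOL-Combinatorics.Multiset_Permutations"
begin

text \<open>
  A permutation in one-line notation is a list; \<open>perms N\<close> contains the permutations of
  \<open>{1..N}\<close>.  Positions are counted from 1, so the entry at position \<open>i\<close> of \<open>p\<close> is \<open>p ! (i - 1)\<close>.
\<close>

abbreviation perms :: "nat \<Rightarrow> nat list set" where
  "perms N \<equiv> permutations_of_set {1..N}"

definition flatten :: "nat list \<Rightarrow> nat list" where
  "flatten xs = map (\<lambda>x. card {y \<in> set xs. y \<le> x}) xs"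

lemma length_flatten [simp]: "length (flatten xs) = length xs"
  by (simp add: flatten_def)

lemma rank_less_iff:
  fixes x y :: nat
  assumes "x \<in> set xs" "y \<in> set xs"
  shows "card {z \<in> set xs. z \<le> x} < card {z \<in> set xs. z \<le> y} \<longleftrightarrow> x < y"
proof
  assume "x < y"
  then have "{z \<in> set xs. z \<le> x} \<subset> {z \<in> set xs. z \<le> y}"
    using assms by (intro psubsetI) (auto simp: set_eq_iff intro: exI[of _ y])
  then show "card {z \<in> set xs. z \<le> x} < card {z \<in> set xs. z \<le> y}"
    by (intro psubset_card_mono) auto
next
  assume less: "card {z \<in> set xs. z \<le> x} < card {z \<in> set xs. z \<le> y}"
  show "x < y"
  proof (rule ccontr)
    assume "\<not> x < y"
    then have "card {z \<in> set xs. z \<le> y} \<le> card {z \<in> set xs. z \<le> x}"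
      by (intro card_mono) auto
    with less show False by simp
  qed
qed

lemma flatten_less_iff:
  assumes "i < length xs" "j < length xs"
  shows "flatten xs ! i < flatten xs ! j \<longleftrightarrow> xs ! i < xs ! j"
  using assms by (simp add: flatten_def rank_less_iff)

lemma flatten_in_perms:
  assumes "distinct xs"
  shows "flatten xs \<in> perms (length xs)"
proof -
  have inj: "inj_on (\<lambda>x. card {y \<in> set xs. y \<le> x}) (set xs)"
    proof (rule inj_onI)
    fix x y
    assume xy: "x \<in> set xs" "y \<in> set xs"
      and eq: "card {z \<in> set xs. z \<le> x} = card {z \<in> set xs. z \<le> y}"
    show "x = y"
      using rank_less_iff[OF xy] rank_less_iff[OF xy(2) xy(1)] eq by simp
  qed
  then have dist: "distinct (flatten xs)"
    unfolding flatten_def distinct_map using assms by blast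
  have "set (flatten xs) \<subseteq> {1..length xs}"
  proof
    fix k assume "k \<in> set (flatten xs)"
    then obtain x where x: "x \<in> set xs" and k: "k = card {y \<in> set xs. y \<le> x}"
      by (auto simp: flatten_def)
    have "card {x} \<le> k"
      unfolding k using x by (intro card_mono) auto
    moreover have "k \<le> card (set xs)"
      unfolding k by (intro card_mono) auto
    ultimately show "k \<in> {1..length xs}"
      using assms by (simp add: distinct_card)
  qed
  moreover have "card (set (flatten xs)) = card {1..length xs}"
    using distinct_card[OF dist] by simp
  ultimately have "set (flatten xs) = {1..length xs}"
    by (intro card_subset_eq) auto
  with dist show ?thesis
    by (simp add: permutations_of_set_def)
qed

lemma flatten_unique:
  assumes xs: "distinct xs" and p: "p \<in> perms (length xs)"
    and order: "\<And>i j. i < length xs \<Longrightarrow> j < length xs \<Longrightarrow> p ! i < p ! j \<longleftrightarrow> xs ! i < xs ! j"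
  shows "p = flatten xs"
proof -
  have setp: "set p = {1..length xs}" and dp: "distinct p"
    using p by (auto simp: permutations_of_set_def)
  then have len: "length p = length xs"
    using distinct_card[OF dp] by simp
  have rank: "card {y \<in> set zs. y \<le> zs ! i} = card {j. j < length zs \<and> zs ! j \<le> zs ! i}"
    if "distinct zs" for zs :: "nat list" and i
  proof -
    have "{y \<in> set zs. y \<le> zs ! i} = (!) zs ` {j. j < length zs \<and> zs ! j \<le> zs ! i}"
      by (auto simp: in_set_conv_nth)
    moreover have "inj_on ((!) zs) {j. j < length zs \<and> zs ! j \<le> zs ! i}"
      using that by (auto simp: inj_on_def nth_eq_iff_index_eq)
    ultimately show ?thesis
      by (simp add: card_image)
  qed
  show ?thesis
  proof (rule nth_equalityI)
    show "length p = length (flatten xs)" by (simp add: len)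
  next
    fix i assume i: "i < length p"
    then have pi: "p ! i \<in> {1..length xs}"
      using setp nth_mem by blast
    then have "{y \<in> set p. y \<le> p ! i} = {1..p ! i}"
      using setp by auto
    then have "p ! i = card {y \<in> set p. y \<le> p ! i}" by simp
    also have "\<dots> = card {j. j < length p \<and> p ! j \<le> p ! i}"
      by (rule rank[OF dp])
    also have "{j. j < length p \<and> p ! j \<le> p ! i} = {j. j < length xs \<and> xs ! j \<le> xs ! i}"
    proof -
      have "p ! j \<le> p ! i \<longleftrightarrow> xs ! j \<le> xs ! i" if "j < length xs" for j
        using order[of i j] i len that by (metis not_less)
      then show ?thesis
        using len by auto
    qed
    also have "card \<dots> = card {y \<in> set xs. y \<le> xs ! i}"
      by (rule rank[OF xs, symmetric])
    also have "\<dots> = flatten xs ! i"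
      using i len by (simp add: flatten_def)
    finally show "p ! i = flatten xs ! i" .
  qed
qed

definition perm_prefix :: "nat list \<Rightarrow> nat \<Rightarrow> nat list" where
  "perm_prefix p i = flatten (take i p)"

definition lr_max_positions :: "nat list \<Rightarrow> nat set" where
  "lr_max_positions p =
     {j \<in> {1..length p}. \<forall>i \<in> {1..<j}. p ! (i - 1) < p ! (j - 1)}"

definition prefix_tree :: "nat \<Rightarrow> nat list set" where
  "prefix_tree N = {p \<in> (\<Union>i\<in>{1..N}. perms i). length p \<in> lr_max_positions p}"

definition contains :: "nat list \<Rightarrow> nat list \<Rightarrow> bool" where
  "contains q p \<longleftrightarrow> perm_prefix q (length p) = p"

definition maximal_antichain :: "nat \<Rightarrow> nat list set \<Rightarrow> bool" where
  "maximal_antichain N A \<longleftrightarrow>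
     A \<subseteq> prefix_tree N \<and>
     (\<forall>p\<in>A. \<forall>q\<in>A. p \<noteq> q \<longrightarrow> \<not> contains p q \<and> \<not> contains q p) \<and>
     (\<forall>p\<in>prefix_tree N. \<exists>q\<in>A. contains p q \<or> contains q p)"

definition stops_at :: "nat list set \<Rightarrow> nat list \<Rightarrow> nat \<Rightarrow> bool" where
  "stops_at A p i \<longleftrightarrow>
     i \<in> {1..length p} \<and> perm_prefix p i \<in> A \<and> (\<forall>j \<in> {1..<i}. perm_prefix p j \<notin> A)"

definition wins :: "nat \<Rightarrow> nat list set \<Rightarrow> nat list \<Rightarrow> bool" where
  "wins N A p \<longleftrightarrow> (\<exists>i. stops_at A p i \<and> p ! (i - 1) = N)"

text \<open>Games are nonempty, so that the uniform distribution on the multiset is meaningful.\<close>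

definition game :: "nat \<Rightarrow> nat list multiset \<Rightarrow> bool" where
  "game N I \<longleftrightarrow> I \<noteq> {#} \<and> set_mset I \<subseteq> perms N"

definition win_prob :: "nat \<Rightarrow> nat list multiset \<Rightarrow> nat list set \<Rightarrow> real" where
  "win_prob N I A = measure_pmf.prob (pmf_of_multiset I) {p. wins N A p}"

definition strategy_indifferent :: "nat \<Rightarrow> nat list multiset \<Rightarrow> bool" where
  "strategy_indifferent N I \<longleftrightarrow>
     (\<forall>A B. maximal_antichain N A \<longrightarrow> maximal_antichain N B \<longrightarrow>
        win_prob N I A = win_prob N I B)"

definition strategically_equivalent ::
    "nat \<Rightarrow> nat list multiset \<Rightarrow> nat list multiset \<Rightarrow> bool" where
  "strategically_equivalent N I I' \<longleftrightarrow>
     (\<forall>A. maximal_antichain N A \<longrightarrow> win_prob N I A = win_prob N I' A)"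

definition append_top :: "nat \<Rightarrow> nat list multiset \<Rightarrow> nat list multiset" where
  "append_top N J' = image_mset (\<lambda>p. p @ [N]) J'"

text \<open>
  The pairs \<open>(p, i)\<close> with \<open>i\<close> a left-to-right maximum position of \<open>p \<in># J\<close>, where each occurrence
  of \<open>p\<close> in \<open>J\<close> contributes its own copy of the pair.
\<close>

definition marked_perms :: "nat list multiset \<Rightarrow> (nat list \<times> nat) multiset" where
  "marked_perms J =
     (\<Sum>p\<in>#J. image_mset (\<lambda>i. (p, i)) (mset_set (lr_max_positions p)))"

text \<open>
  \<open>rel_mset\<close> matches the occurrences in the two multisets bijectively, so different choices of the
  new permutation are allowed for different occurrences of the same pair.
\<close>

definition arises_from :: "nat \<Rightarrow> nat list multiset \<Rightarrow> nat list multiset \<Rightarrow> bool" where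
  "arises_from N J' I' \<longleftrightarrow>
     rel_mset
       (\<lambda>(p, i) q. q \<in> perms N \<and> perm_prefix q i = perm_prefix p i \<and> q ! (i - 1) = N)
       (marked_perms (append_top N J')) I'"

end

theory Submission
  imports Defs
begin

text \<open>
  The maximal elements of the prefix tree are the permutations ending in \<open>N\<close>, its leaves.  For a
  prefix \<open>p\<close> let \<open>w p\<close> be the number of permutations of the game that win when stopped at \<open>p\<close>; a
  maximal antichain \<open>A\<close> wins \<open>\<Sum>p\<in>A. w p\<close> times.  Comparing the antichain of all leaves with the
  one consisting of \<open>p\<close> and the leaves not above \<open>p\<close> shows that in a strategy-indifferent game
  \<open>w p\<close> is the sum of \<open>w\<close> over the leaves above \<open>p\<close>.  This is exactly the weight of \<open>p\<close> in the
  game constructed from the leaves counted with weight \<open>w\<close>, and as every permutation wins at exactly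
  one prefix, summing over \<open>p\<close> shows that both games have the same size.  Conversely, in a
  constructed game every maximal antichain wins \<open>size J'\<close> times, since it meets the chain below each
  leaf exactly once.
\<close>

section \<open>Multisets\<close>

lemma size_filter_mset_conv_sum: "size (filter_mset P M) = (\<Sum>x\<in>#M. if P x then 1 else 0)"
  by (induction M) auto

text \<open>Double counting: both sides count the pairs of an occurrence \<open>x\<close> in
  \<open>M\<close> and an \<open>s\<close> in \<open>S\<close> with \<open>P x s\<close>.\<close>

lemma sum_mset_card_swap:
  assumes "finite S"
  shows "(\<Sum>x\<in>#M. card {s \<in> S. P x s}) = (\<Sum>s\<in>S. size (filter_mset (\<lambda>x. P x s) M))"
proof (induction M)
  case (add x M)
  have "card {s \<in> S. P x s} = (\<Sum>s\<in>S. if P x s then 1 else 0)"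
    using assms by (simp add: sum.If_cases Int_def)
  then show ?case
    using add by (simp only: size_filter_mset_conv_sum image_mset_add_mset sum_mset.add_mset sum.distrib)
qed simp

lemma size_filter_mset_disj:
  assumes "\<And>x. x \<in># M \<Longrightarrow> \<not> (P x \<and> Q x)"
  shows "size (filter_mset (\<lambda>x. P x \<or> Q x) M) = size (filter_mset P M) + size (filter_mset Q M)"
  using assms by (induction M) auto

text \<open>\<open>rel_mset\<close> pairs the occurrences off, and the two predicates agree on each
  pair. Membership of \<open>x\<close> in \<open>M\<close> is available because the intended
  equivalence holds only for genuine marked positions.\<close>

lemma rel_mset_size_filter:
  assumes "rel_mset R M K" and "\<And>x y. x \<in># M \<Longrightarrow> R x y \<Longrightarrow> P x \<longleftrightarrow> Q y"
  shows "size (filter_mset P M) = size (filter_mset Q K)"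
  using assms
proof (induction rule: rel_mset_induct)
  case (add R a b M K)
  have "P a \<longleftrightarrow> Q b"
    by (rule add.prems[OF _ add.hyps(1)]) simp
  moreover have "size (filter_mset P M) = size (filter_mset Q K)"
    by (intro add.IH add.prems) auto
  ultimately show ?case by simp
qed simp

lemma rel_mset_memberD:
  assumes "rel_mset R M K" "y \<in># K"
  shows "\<exists>x. x \<in># M \<and> R x y"
proof -
  obtain xs ys where xs: "mset xs = M" and ys: "mset ys = K" and R: "list_all2 R xs ys"
    using assms(1) by (auto simp: rel_mset_def)
  obtain k where k: "k < length ys" "ys ! k = y"
    using assms(2) ys by (auto simp: in_set_conv_nth)
  then have "R (xs ! k) y" "xs ! k \<in># M"
    using R xs by (auto simp: list_all2_conv_all_nth)
  then show ?thesis by blast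
qed

lemma rel_mset_exists:
  assumes "\<And>x. x \<in># M \<Longrightarrow> \<exists>y. R x y"
  shows "\<exists>K. rel_mset R M K"
  using assms
proof (induction M)
  case (add x M)
  obtain y where "R x y"
    using add.prems[of x] by auto
  moreover have "\<exists>y. R z y" if "z \<in># M" for z
    using that by (intro add.prems) simp
  then obtain K where "rel_mset R M K"
    using add.IH by blast
  ultimately have "rel_mset R (add_mset x M) (add_mset y K)"
    by (rule rel_mset_Plus)
  then show ?case ..
qed (use rel_mset_Zero in blast)

lemma prob_pmf_of_multiset:
  assumes "M \<noteq> {#}"
  shows "measure_pmf.prob (pmf_of_multiset M) {x. P x} = size (filter_mset P M) / size M"
proof -
  \<comment> \<open>The event may be infinite; intersecting it with the finite support makes its
    probability a finite sum.\<close>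
  have "measure_pmf.prob (pmf_of_multiset M) {x. P x}
      = measure_pmf.prob (pmf_of_multiset M) (set_mset (filter_mset P M))"
    using assms by (intro measure_prob_cong_0) (auto simp: set_pmf_iff not_in_iff)
  also have "\<dots> = (\<Sum>x\<in>set_mset (filter_mset P M). count M x / size M)"
    using assms by (simp add: measure_measure_pmf_finite)
  also have "\<dots> = (\<Sum>x\<in>set_mset (filter_mset P M). count (filter_mset P M) x) / size M"
    by (simp add: sum_divide_distrib)
  finally show ?thesis
    by (simp only: size_multiset_overloaded_eq)
qed

section \<open>Prefixes and the prefix tree\<close>

lemma permsD:
  assumes "p \<in> perms N"
  shows "set p = {1..N}" "distinct p" "length p = N"
  using assms length_finite_permutations_of_set[OF assms] permutations_of_setD[OF assms] by auto

lemma length_perm_prefix: "length (perm_prefix p i) = min (length p) i"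
  by (simp add: perm_prefix_def)

lemma perm_prefix_in_perms: "distinct p \<Longrightarrow> i \<le> length p \<Longrightarrow> perm_prefix p i \<in> perms i"
  unfolding perm_prefix_def using flatten_in_perms[of "take i p"] by simp

lemma perm_prefix_less_iff:
  assumes "a < i" "b < i" "i \<le> length p"
  shows "perm_prefix p i ! a < perm_prefix p i ! b \<longleftrightarrow> p ! a < p ! b"
  unfolding perm_prefix_def using assms flatten_less_iff[of a "take i p" b] by simp

lemma flatten_perms: "p \<in> perms N \<Longrightarrow> flatten p = p"
  using flatten_unique[of p p] permsD[of p N] by simp

lemma perm_prefix_perms: "p \<in> perms N \<Longrightarrow> perm_prefix p N = p"
  using permsD[of p N] by (simp add: perm_prefix_def flatten_perms)

lemma perm_prefix_perm_prefix:
  assumes p: "distinct p" and ij: "i \<le> j" "j \<le> length p"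
  shows "perm_prefix (perm_prefix p j) i = perm_prefix p i"
proof -
  have "perm_prefix (perm_prefix p j) i = flatten (take i p)"
  proof (rule flatten_unique)
    have "perm_prefix p j \<in> perms j"
      using p ij by (intro perm_prefix_in_perms)
    from permsD[OF this] show "perm_prefix (perm_prefix p j) i \<in> perms (length (take i p))"
      using perm_prefix_in_perms[of "perm_prefix p j" i] ij by simp
  qed (use p ij in \<open>auto simp: perm_prefix_less_iff length_perm_prefix\<close>)
  then show ?thesis
    by (simp add: perm_prefix_def)
qed

text \<open>The tree property: the prefixes of one permutation form a chain, because a prefix of a
  prefix is again a prefix.\<close>

lemma contains_comparable:
  assumes "distinct q" "length p \<le> length p'" "contains q p" "contains q p'"
  shows "contains p' p"
proof -
  have "length p' \<le> length q"
    using assms(4) by (metis contains_def length_perm_prefix min.cobounded1)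
  then show ?thesis
    using assms perm_prefix_perm_prefix[of q "length p" "length p'"] by (simp add: contains_def)
qed

lemma lr_max_positions_perm_prefix:
  assumes "i \<in> {1..length p}"
  shows "i \<in> lr_max_positions (perm_prefix p i) \<longleftrightarrow> i \<in> lr_max_positions p"
proof -
  have "(\<forall>j\<in>{1..<i}. perm_prefix p i ! (j - 1) < perm_prefix p i ! (i - 1)) \<longleftrightarrow>
      (\<forall>j\<in>{1..<i}. p ! (j - 1) < p ! (i - 1))"
    using assms by (intro ball_cong refl perm_prefix_less_iff) auto
  then show ?thesis
    using assms by (simp add: lr_max_positions_def length_perm_prefix)
qed

lemma perm_prefix_in_prefix_tree_iff:
  assumes "p \<in> perms N" "i \<in> {1..N}"
  shows "perm_prefix p i \<in> prefix_tree N \<longleftrightarrow> i \<in> lr_max_positions p"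
proof -
  have "perm_prefix p i \<in> perms i"
    using assms permsD[OF assms(1)] by (intro perm_prefix_in_perms) auto
  then show ?thesis
    using assms permsD[OF assms(1)] lr_max_positions_perm_prefix[of i p]
    unfolding prefix_tree_def by (auto simp: length_perm_prefix)
qed

lemma prefix_treeD:
  assumes "p \<in> prefix_tree N"
  shows "p \<in> perms (length p)" "length p \<in> {1..N}" "length p \<in> lr_max_positions p"
  using assms permsD(3) unfolding prefix_tree_def by auto

lemma finite_prefix_tree: "finite (prefix_tree N)"
  unfolding prefix_tree_def by auto

section \<open>Left-to-right maxima and the position of the top entry\<close>

lemma lr_max_positions_subset: "lr_max_positions p \<subseteq> {1..length p}"
  by (auto simp: lr_max_positions_def)

lemma top_position_lr_max:
  assumes q: "q \<in> perms N" and i: "i \<in> {1..N}" "q ! (i - 1) = N"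
  shows "i \<in> lr_max_positions q"
proof -
  have "q ! (j - 1) < N" if "j \<in> {1..<i}" for j
  proof -
    have "q ! (j - 1) \<in> {1..N}"
      using permsD[OF q] that i nth_mem[of "j - 1" q] by auto
    moreover have "q ! (j - 1) \<noteq> q ! (i - 1)"
      using permsD[OF q] that i by (subst nth_eq_iff_index_eq) auto
    ultimately show ?thesis
      using i by auto
  qed
  then show ?thesis
    using i permsD[OF q] by (auto simp: lr_max_positions_def)
qed

lemma top_position_exists:
  assumes "q \<in> perms N" "N \<ge> 1"
  shows "\<exists>i\<in>{1..N}. q ! (i - 1) = N"
proof -
  obtain k where "k < N" "q ! k = N"
    using permsD[OF assms(1)] assms(2) by (metis atLeastAtMost_iff in_set_conv_nth order_refl)
  then show ?thesis
    by (intro bexI[of _ "Suc k"]) auto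
qed

lemma top_position_unique:
  assumes "q \<in> perms N" "i \<in> {1..N}" "j \<in> {1..N}" "q ! (i - 1) = N" "q ! (j - 1) = N"
  shows "i = j"
proof -
  have "i - 1 < length q" "j - 1 < length q"
    using assms(2,3) permsD(3)[OF assms(1)] by auto
  then have "i - 1 = j - 1"
    using assms(4,5) permsD(2)[OF assms(1)] nth_eq_iff_index_eq by metis
  then show ?thesis
    using assms(2,3) by auto
qed

lemma raise_last_entry:
  assumes p: "p \<in> perms N" and i: "i \<in> lr_max_positions p"
  shows "\<exists>q. q \<in> perms N \<and> perm_prefix q i = perm_prefix p i \<and> q ! (i - 1) = N"
proof -
  define t where "t = perm_prefix p i"
  have iN: "i \<in> {1..N}"
    using i permsD[OF p] by (auto simp: lr_max_positions_def)
  have tp: "t \<in> perms i"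
    unfolding t_def using permsD[OF p] iN by (intro perm_prefix_in_perms) auto
  have "i \<in> lr_max_positions t"
    unfolding t_def using lr_max_positions_perm_prefix i iN permsD[OF p] by simp
  then have tmax: "t ! a < t ! (i - 1)" if "a < i - 1" for a
  proof -
    have "Suc a \<in> {1..<i}"
      using that by auto
    then have "t ! (Suc a - 1) < t ! (i - 1)"
      using \<open>i \<in> lr_max_positions t\<close> unfolding lr_max_positions_def by blast
    then show ?thesis by simp
  qed
  obtain j where j: "j \<in> {1..i}" "t ! (j - 1) = i"
    using top_position_exists[OF tp] iN by auto
  \<comment> \<open>The last entry of \<open>t\<close> exceeds all others, so the largest value
    \<open>i\<close> can only stand in the last place.\<close>
  have "j = i"
  proof (rule ccontr)
    assume "j \<noteq> i"
    then have "j - 1 < i - 1"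
      using j(1) by auto
    then have "i < t ! (i - 1)"
      using tmax[of "j - 1"] j(2) by simp
    moreover have "t ! (i - 1) \<in> {1..i}"
      using nth_mem[of "i - 1" t] iN unfolding permsD[OF tp] by simp
    ultimately show False by simp
  qed
  with j have last: "t ! (i - 1) = i" by simp
  define b where "b = butlast t"
  have lb: "length b = i - 1"
    using permsD[OF tp] by (simp add: b_def)
  have "t \<noteq> []"
    using permsD(3)[OF tp] iN by auto
  then have tb: "t = b @ [i]"
    using append_butlast_last_id[of t] permsD(3)[OF tp] last
    by (simp add: b_def last_conv_nth)
  have db: "distinct b" "i \<notin> set b" "insert i (set b) = {1..i}"
    using permsD[OF tp] tb by auto
  then have "set b = {1..i} - {i}" by blast
  also have "\<dots> = {1..<i}" by auto
  finally have sb: "set b = {1..<i}" .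
  \<comment> \<open>Here \<open>b\<close> uses up the values below \<open>i\<close>, so exactly
    \<open>i\<close>, ..., \<open>N - 1\<close> are left to place after \<open>N\<close>.\<close>
  define q where "q = b @ [N] @ [i..<N]"
  have q: "q \<in> perms N"
  proof (rule permutations_of_setI)
    have "set q = {1..<i} \<union> {i..<N} \<union> {N}"
      by (simp add: q_def sb)
    also have "\<dots> = {1..N}"
      using iN by auto
    finally show "set q = {1..N}" .
    show "distinct q"
      using iN by (simp add: q_def sb db(1))
  qed
  have "t = flatten (take i q)"
  proof (rule flatten_unique)
    have tq: "take i q = b @ [N]"
      using lb iN by (simp add: q_def)
    show "distinct (take i q)"
      using q permsD by simp
    show "t \<in> perms (length (take i q))"
      using tp tq lb iN by simp
    fix k l assume kl: "k < length (take i q)" "l < length (take i q)"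
    have less: "b ! a < i \<and> b ! a < N" if "a < i - 1" for a
    proof -
      have "b ! a \<in> {1..<i}"
        using nth_mem[of a b] that unfolding lb sb by blast
      with iN show ?thesis by simp
    qed
    show "t ! k < t ! l \<longleftrightarrow> take i q ! k < take i q ! l"
      using kl lb less[of k] less[of l] unfolding tq tb by (auto simp: nth_append)
  qed
  moreover have "q ! (i - 1) = N"
    using lb by (simp add: q_def nth_append)
  ultimately show ?thesis
    using q unfolding t_def perm_prefix_def by metis
qed

section \<open>Leaves and antichains\<close>

definition leaves :: "nat \<Rightarrow> nat list set" where
  "leaves N = {q \<in> perms N. q ! (N - 1) = N}"

lemma leaves_subset_prefix_tree:
  assumes "N \<ge> 1"
  shows "leaves N \<subseteq> prefix_tree N"
proof
  fix q assume q: "q \<in> leaves N"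
  then have "q \<in> perms N" "N \<in> lr_max_positions q"
    using top_position_lr_max[of q N N] assms by (auto simp: leaves_def)
  then show "q \<in> prefix_tree N"
    using assms perm_prefix_in_prefix_tree_iff[of q N N] perm_prefix_perms by simp
qed

lemma leaves_conv_append:
  assumes "N \<ge> 1"
  shows "leaves N = (\<lambda>p. p @ [N]) ` perms (N - 1)"
proof (intro set_eqI iffI)
  fix q assume q: "q \<in> leaves N"
  then have qp: "q \<in> perms N" by (simp add: leaves_def)
  have ne: "q \<noteq> []" using permsD[OF qp] assms by auto
  have "last q = N"
    using q permsD[OF qp] ne by (simp add: leaves_def last_conv_nth)
  then have eq: "butlast q @ [N] = q"
    using append_butlast_last_id[OF ne] by simp
  have dist: "distinct (butlast q @ [N])" and set: "set (butlast q @ [N]) = {1..N}"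
    unfolding eq by (rule permsD[OF qp])+
  have "set (butlast q) = set (butlast q @ [N]) - {N}"
    using dist by auto
  also have "\<dots> = {1..N - 1}"
    unfolding set by auto
  finally have "butlast q \<in> perms (N - 1)"
    using dist by (intro permutations_of_setI) simp_all
  with eq[symmetric] show "q \<in> (\<lambda>p. p @ [N]) ` perms (N - 1)" by blast
next
  fix q assume "q \<in> (\<lambda>p. p @ [N]) ` perms (N - 1)"
  then obtain p where p: "p \<in> perms (N - 1)" "q = p @ [N]" by auto
  have "insert N {1..N - 1} = {1..N}"
    using assms by auto
  then have "q \<in> perms N"
    using permsD[OF p(1)] p(2) assms by (intro permutations_of_setI) simp_all
  then show "q \<in> leaves N"
    using permsD[OF p(1)] p(2) by (simp add: leaves_def nth_append)
qed

lemma contained_in_leaf: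
  assumes p: "p \<in> prefix_tree N"
  shows "\<exists>q\<in>leaves N. contains q p"
proof (cases "length p = N")
  case True
  define n where "n = length p"
  have pp: "p \<in> perms n" and n: "n \<in> {1..N}" "n \<in> lr_max_positions p"
    using prefix_treeD[OF p] by (auto simp: n_def)
  \<comment> \<open>For a prefix of full length, raising the last entry yields a permutation with
    the same full prefix. It is therefore \<open>p\<close> itself, which shows that \<open>p\<close>
    already ends in its top value.\<close>
  obtain q where q: "q \<in> perms n" "perm_prefix q n = perm_prefix p n" "q ! (n - 1) = n"
    using raise_last_entry[OF pp n(2)] by blast
  then have "q = p"
    using perm_prefix_perms pp by metis
  moreover have "contains p p"
    using perm_prefix_perms[OF pp] by (simp add: contains_def n_def)
  ultimately show ?thesis
    using q True by (intro bexI[of _ p]) (simp_all add: leaves_def n_def)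
next
  case False
  \<comment> \<open>The missing values are appended in increasing order: the initial segment stays
    \<open>p\<close> and \<open>N\<close> comes last.\<close>
  define q where "q = p @ [Suc (length p)..<Suc N]"
  have n: "length p \<in> {1..<N}"
    using prefix_treeD(2)[OF p] False by auto
  have q: "q \<in> perms N"
  proof (rule permutations_of_setI)
    note pD = permsD[OF prefix_treeD(1)[OF p]]
    have "set q = {1..length p} \<union> {Suc (length p)..<Suc N}"
      unfolding q_def set_append pD(1) by (simp del: upt_Suc)
    also have "\<dots> = {1..N}"
      using n by auto
    finally show "set q = {1..N}" .
    show "distinct q"
      using pD(2) unfolding q_def distinct_append pD(1) by (auto simp del: upt_Suc)
  qed
  moreover have "q ! (N - 1) = N"
    using n by (auto simp: q_def nth_append simp del: upt_Suc)
  moreover have "contains q p"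
    using flatten_perms[OF prefix_treeD(1)[OF p]] by (simp add: contains_def perm_prefix_def q_def)
  ultimately show ?thesis
    by (auto simp: leaves_def)
qed

text \<open>Leaves are maximal in the tree because they already have the full length
  \<open>N\<close>.\<close>

lemma leaf_contained_eq:
  assumes p: "p \<in> prefix_tree N" and q: "q \<in> leaves N" and c: "contains p q"
  shows "p = q"
proof -
  have "length q = N"
    using q permsD by (auto simp: leaves_def)
  then have "N \<le> length p"
    using c by (metis contains_def length_perm_prefix min.cobounded1)
  then have "length p = N"
    using prefix_treeD(2)[OF p] by simp
  then show ?thesis
    using c prefix_treeD(1)[OF p] perm_prefix_perms \<open>length q = N\<close> by (metis contains_def)
qed

text \<open>All leaves above \<open>p\<close> are traded for \<open>p\<close>. Any \<open>r\<close>
  lies below some leaf; either that leaf is kept, or it contains both \<open>p\<close> and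
  \<open>r\<close>, which are then comparable.\<close>

lemma maximal_antichain_cut:
  assumes N: "N \<ge> 1" and p: "p \<in> prefix_tree N"
  shows "maximal_antichain N (insert p {l \<in> leaves N. \<not> contains l p})"
  unfolding maximal_antichain_def
proof (intro conjI ballI impI)
  let ?A = "insert p {l \<in> leaves N. \<not> contains l p}"
  note sub = leaves_subset_prefix_tree[OF N]
  show A: "?A \<subseteq> prefix_tree N"
    using p sub by blast
  have main: "\<not> contains r s" if "r \<in> ?A" "s \<in> ?A" "r \<noteq> s" for r s
  proof
    assume c: "contains r s"
    show False
    proof (cases "s = p")
      case True
      with c that show False by blast
    next
      case False
      then show False
        using leaf_contained_eq[of r N s] c that A by blast
    qed
  qed
  show "\<not> contains r s" "\<not> contains s r" if "r \<in> ?A" "s \<in> ?A" "r \<noteq> s" for r s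
    by (fact main[OF that], fact main[OF that(2,1) that(3)[symmetric]])
  fix r assume r: "r \<in> prefix_tree N"
  obtain l where l: "l \<in> leaves N" "contains l r"
    using contained_in_leaf[OF r] by blast
  have dl: "distinct l"
    using l(1) permsD by (auto simp: leaves_def)
  show "\<exists>s\<in>?A. contains r s \<or> contains s r"
  proof (cases "contains l p")
    case True
    then have "contains r p \<or> contains p r"
      using contains_comparable[OF dl _ l(2)] contains_comparable[OF dl _ _ l(2)] nat_le_linear
      by blast
    then show ?thesis by blast
  qed (use l in blast)
qed

lemma maximal_antichain_leaves:
  assumes "N \<ge> 1"
  shows "maximal_antichain N (leaves N)"
proof -
  \<comment> \<open>The cut at a leaf trades that leaf for itself, so the cut at the identity is the
    set of all leaves.\<close>
  have l: "[1..<Suc N] \<in> leaves N"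
    using assms by (simp add: leaves_def permutations_of_set_def atLeastLessThanSuc_atLeastAtMost
      del: upt_Suc)
  have "insert [1..<Suc N] {l \<in> leaves N. \<not> contains l [1..<Suc N]} = leaves N"
  proof -
    have "\<not> contains q [1..<Suc N]" if "q \<in> leaves N" "q \<noteq> [1..<Suc N]" for q
      using leaf_contained_eq[OF _ l] leaves_subset_prefix_tree[OF assms] that by blast
    then show ?thesis
      using l by blast
  qed
  with maximal_antichain_cut[OF assms, of "[1..<Suc N]"] show ?thesis
    using l leaves_subset_prefix_tree[OF assms] by (metis subsetD)
qed

text \<open>The eligible prefixes of a leaf form a chain, which an antichain meets at most once.
  Maximality gives an element comparable to \<open>l\<close>, and as \<open>l\<close> is maximal in
  the tree, that element is a prefix of \<open>l\<close>.\<close>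

lemma card_antichain_below_leaf:
  assumes A: "maximal_antichain N A" and N: "N \<ge> 1" and l: "l \<in> leaves N"
  shows "card {i \<in> lr_max_positions l. perm_prefix l i \<in> A} = 1"
proof -
  have lp: "l \<in> perms N"
    using l by (simp add: leaves_def)
  have lt: "l \<in> prefix_tree N"
    using l leaves_subset_prefix_tree[OF N] by blast
  obtain s where s: "s \<in> A" "contains l s \<or> contains s l"
    using A lt by (auto simp: maximal_antichain_def)
  have st: "s \<in> prefix_tree N"
    using s A by (auto simp: maximal_antichain_def)
  have "contains l l"
    unfolding contains_def permsD(3)[OF lp] by (rule perm_prefix_perms[OF lp])
  then have ls: "perm_prefix l (length s) = s"
    using s(2) leaf_contained_eq[OF st l] unfolding contains_def by blast
  have uniq: "i = length s" if i: "i \<in> lr_max_positions l" "perm_prefix l i \<in> A" for i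
  proof -
    have len: "length (perm_prefix l i) = i"
      using i permsD[OF lp] by (auto simp: length_perm_prefix lr_max_positions_def)
    have c: "contains l (perm_prefix l i)" "contains l s"
      using ls by (auto simp: contains_def len)
    have "contains s (perm_prefix l i) \<or> contains (perm_prefix l i) s"
      using contains_comparable[OF permsD(2)[OF lp]] c nat_le_linear by blast
    then have "perm_prefix l i = s"
      using A s(1) i(2) by (auto simp: maximal_antichain_def)
    with len show ?thesis by simp
  qed
  have "length s \<in> lr_max_positions l" "perm_prefix l (length s) \<in> A"
    using perm_prefix_in_prefix_tree_iff[OF lp prefix_treeD(2)[OF st]] st s(1)
    unfolding ls by simp_all
  then have "{i \<in> lr_max_positions l. perm_prefix l i \<in> A} = {length s}"
    using uniq by blast
  then show ?thesis by simp
qed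

section \<open>Winning prefixes\<close>

lemma wins_iff:
  assumes A: "maximal_antichain N A" and q: "q \<in> perms N"
  shows "wins N A q \<longleftrightarrow> (\<exists>i\<in>{1..N}. perm_prefix q i \<in> A \<and> q ! (i - 1) = N)"
proof
  assume "wins N A q"
  then show "\<exists>i\<in>{1..N}. perm_prefix q i \<in> A \<and> q ! (i - 1) = N"
    using permsD[OF q] by (auto simp: wins_def stops_at_def)
next
  assume "\<exists>i\<in>{1..N}. perm_prefix q i \<in> A \<and> q ! (i - 1) = N"
  then obtain i where i: "i \<in> {1..N}" "perm_prefix q i \<in> A" "q ! (i - 1) = N" by blast
  \<comment> \<open>No earlier stop can occur: two prefixes of \<open>q\<close> of different lengths
    in \<open>A\<close> would be comparable.\<close>
  have "perm_prefix q j \<notin> A" if j: "j \<in> {1..<i}" for j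
  proof
    assume jA: "perm_prefix q j \<in> A"
    have len: "length (perm_prefix q j) = j" "length (perm_prefix q i) = i"
      using i j permsD[OF q] by (auto simp: length_perm_prefix)
    have "contains (perm_prefix q i) (perm_prefix q j)"
      using i j permsD[OF q] len by (simp add: contains_def perm_prefix_perm_prefix)
    moreover have "perm_prefix q i \<noteq> perm_prefix q j"
      using len j by auto
    ultimately show False
      using A i(2) jA by (auto simp: maximal_antichain_def)
  qed
  then show "wins N A q"
    using i permsD[OF q] by (auto simp: wins_def stops_at_def)
qed

lemma wins_leaves_iff:
  assumes N: "N \<ge> 1" and q: "q \<in> perms N"
  shows "wins N (leaves N) q \<longleftrightarrow> q \<in> leaves N"
proof -
  have "i = N" if "i \<in> {1..N}" "perm_prefix q i \<in> leaves N" for i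
    using that permsD(3)[of "perm_prefix q i" N] permsD(3)[OF q]
    by (auto simp: leaves_def length_perm_prefix)
  moreover have "perm_prefix q N = q"
    by (rule perm_prefix_perms[OF q])
  ultimately show ?thesis
    unfolding wins_iff[OF maximal_antichain_leaves[OF N] q]
    using N q by (auto simp: leaves_def intro!: bexI[of _ N]) fastforce+
qed

text \<open>Stopping \<open>q\<close> at the prefix \<open>p\<close> wins. The weight
  \<open>w p\<close> is the number of occurrences in the game that satisfy this.\<close>

definition hits :: "nat \<Rightarrow> nat list \<Rightarrow> nat list \<Rightarrow> bool" where
  "hits N p q \<longleftrightarrow> contains q p \<and> q ! (length p - 1) = N"

text \<open>Lengths decide at which position the strike set can be met: \<open>p\<close> only at
  position \<open>length p\<close>, a leaf only at position \<open>N\<close>, where the prefix is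
  \<open>q\<close> itself.\<close>

lemma wins_cut_iff:
  assumes N: "N \<ge> 1" and p: "p \<in> prefix_tree N" and q: "q \<in> perms N"
  shows "wins N (insert p {l \<in> leaves N. \<not> contains l p}) q \<longleftrightarrow>
    hits N p q \<or> q \<in> leaves N \<and> \<not> contains q p"
proof -
  have 1: "i = N" if "i \<in> {1..N}" "perm_prefix q i \<in> leaves N" for i
    using that permsD(3)[of "perm_prefix q i" N] permsD(3)[OF q]
    by (auto simp: leaves_def length_perm_prefix)
  have 2: "i = length p" if "i \<in> {1..N}" "perm_prefix q i = p" for i
    using that permsD(3)[OF q] by (auto simp: length_perm_prefix)
  have 3: "perm_prefix q N = q"
    by (rule perm_prefix_perms[OF q])
  show ?thesis
    unfolding wins_iff[OF maximal_antichain_cut[OF N p] q]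
  proof
    assume "\<exists>i\<in>{1..N}. perm_prefix q i \<in> insert p {l \<in> leaves N. \<not> contains l p} \<and> q ! (i - 1) = N"
    then obtain i where i: "i \<in> {1..N}" "q ! (i - 1) = N"
        "perm_prefix q i = p \<or> perm_prefix q i \<in> leaves N \<and> \<not> contains (perm_prefix q i) p"
      by blast
    then show "hits N p q \<or> q \<in> leaves N \<and> \<not> contains q p"
      using 1[of i] 2[of i] 3 by (auto simp: hits_def contains_def)
  next
    assume "hits N p q \<or> q \<in> leaves N \<and> \<not> contains q p"
    then show "\<exists>i\<in>{1..N}. perm_prefix q i \<in> insert p {l \<in> leaves N. \<not> contains l p} \<and> q ! (i - 1) = N"
    proof
      assume "hits N p q"
      then show ?thesis
        using prefix_treeD(2)[OF p] by (intro bexI[of _ "length p"]) (auto simp: hits_def contains_def)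
    next
      assume "q \<in> leaves N \<and> \<not> contains q p"
      then show ?thesis
        using N 3 by (intro bexI[of _ N]) (auto simp: leaves_def)
    qed
  qed
qed

text \<open>The only candidate is the prefix that ends where \<open>N\<close> stands, and it is
  eligible since \<open>N\<close> is always a left-to-right maximum.\<close>

lemma card_hits:
  assumes N: "N \<ge> 1" and q: "q \<in> perms N"
  shows "card {p \<in> prefix_tree N. hits N p q} = 1"
proof -
  obtain i where i: "i \<in> {1..N}" "q ! (i - 1) = N"
    using top_position_exists[OF q N] by blast
  have len: "length (perm_prefix q i) = i"
    using i permsD[OF q] by (auto simp: length_perm_prefix)
  have "{p \<in> prefix_tree N. hits N p q} = {perm_prefix q i}"
  proof (intro set_eqI iffI)
    fix p assume "p \<in> {p \<in> prefix_tree N. hits N p q}"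
    then have p: "p \<in> prefix_tree N" "contains q p" "q ! (length p - 1) = N"
      by (auto simp: hits_def)
    then have "length p = i"
      using top_position_unique[OF q prefix_treeD(2)[OF p(1)] i(1) p(3) i(2)] by simp
    then show "p \<in> {perm_prefix q i}"
      using p by (simp add: contains_def)
  next
    fix p assume "p \<in> {perm_prefix q i}"
    then show "p \<in> {p \<in> prefix_tree N. hits N p q}"
      using perm_prefix_in_prefix_tree_iff[OF q i(1)] top_position_lr_max[OF q i] len i
      by (auto simp: hits_def contains_def)
  qed
  then show ?thesis by simp
qed

text \<open>Eligible prefixes correspond to left-to-right maximum positions through their length.
  This turns a count in the tree into the number of copies that the construction makes.\<close>

lemma card_contained:
  assumes q: "q \<in> perms N"
  shows "card {p \<in> prefix_tree N. contains q p} = card (lr_max_positions q)"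
proof -
  have len: "length (perm_prefix q i) = i" if "i \<in> lr_max_positions q" for i
    using that by (auto simp: length_perm_prefix lr_max_positions_def)
  have "bij_betw (perm_prefix q) (lr_max_positions q) {p \<in> prefix_tree N. contains q p}"
  proof (rule bij_betwI[where g = length])
    show "perm_prefix q \<in> lr_max_positions q \<rightarrow> {p \<in> prefix_tree N. contains q p}"
    proof
      fix i assume i: "i \<in> lr_max_positions q"
      then have "i \<in> {1..N}"
        using lr_max_positions_subset permsD(3)[OF q] by blast
      then show "perm_prefix q i \<in> {p \<in> prefix_tree N. contains q p}"
        using perm_prefix_in_prefix_tree_iff[OF q] i len by (auto simp: contains_def)
    qed
    show "length \<in> {p \<in> prefix_tree N. contains q p} \<rightarrow> lr_max_positions q"
    proof
      fix p assume "p \<in> {p \<in> prefix_tree N. contains q p}"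
      then have "p \<in> prefix_tree N" "perm_prefix q (length p) = p"
        by (auto simp: contains_def)
      then show "length p \<in> lr_max_positions q"
        using perm_prefix_in_prefix_tree_iff[OF q, of "length p"] prefix_treeD(2) by auto
    qed
  qed (auto simp: len contains_def)
  then show ?thesis
    by (simp add: bij_betw_same_card)
qed

section \<open>Counting wins\<close>

lemma set_marked_perms: "x \<in># marked_perms J \<Longrightarrow> fst x \<in># J \<and> snd x \<in> lr_max_positions (fst x)"
  using finite_subset[OF lr_max_positions_subset] by (auto simp: marked_perms_def)

lemma size_filter_marked_perms:
  "size (filter_mset P (marked_perms J)) =
    (\<Sum>p\<in>#J. card {i \<in> lr_max_positions p. P (p, i)})"
proof (induction J)
  case (add p J)
  \<comment> \<open>\<open>mset_set\<close> is empty on infinite sets, so finiteness is needed for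
    it to list the positions.\<close>
  have "finite (lr_max_positions p)"
    using finite_subset[OF lr_max_positions_subset] by auto
  then have "size (filter_mset P (image_mset (\<lambda>i. (p, i)) (mset_set (lr_max_positions p))))
      = card {i \<in> lr_max_positions p. P (p, i)}"
    by (simp add: filter_mset_image_mset filter_mset_mset_set)
  then show ?case
    using add by (simp add: marked_perms_def)
qed (simp add: marked_perms_def)

section \<open>Games constructed from leaves\<close>

lemma set_append_top:
  assumes "N \<ge> 1" "set_mset J' \<subseteq> perms (N - 1)"
  shows "set_mset (append_top N J') \<subseteq> leaves N"
  using assms(2) unfolding leaves_conv_append[OF assms(1)] append_top_def by auto

lemma arises_from_exists:
  assumes "N \<ge> 1" "set_mset J' \<subseteq> perms (N - 1)"
  shows "\<exists>I'. arises_from N J' I'"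
  unfolding arises_from_def
proof (rule rel_mset_exists)
  fix x assume "x \<in># marked_perms (append_top N J')"
  then have "fst x \<in> perms N" "snd x \<in> lr_max_positions (fst x)"
    using set_marked_perms[of x] set_append_top[OF assms] by (auto simp: leaves_def)
  from raise_last_entry[OF this]
  show "\<exists>q. (case x of (p, i) \<Rightarrow> \<lambda>q. q \<in> perms N \<and> perm_prefix q i = perm_prefix p i \<and> q ! (i - 1) = N) q"
    by (simp add: case_prod_beta)
qed

lemma arises_from_subset:
  assumes "arises_from N J' I'"
  shows "set_mset I' \<subseteq> perms N"
  using rel_mset_memberD[OF assms[unfolded arises_from_def]] by fastforce

lemma arises_from_size:
  assumes "arises_from N J' I'"
  shows "size I' = (\<Sum>p\<in>#append_top N J'. card (lr_max_positions p))"
  using rel_mset_size[OF assms[unfolded arises_from_def]]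
    size_filter_marked_perms[of "\<lambda>_. True" "append_top N J'"] by simp

text \<open>The copy made for \<open>(p, i)\<close> has its top entry at \<open>i\<close>, so it
  wins exactly if the prefix it shares there with \<open>p\<close> lies in \<open>A\<close>. For
  each leaf in the multiset this happens at exactly one \<open>i\<close>.\<close>

lemma arises_from_win_count:
  assumes N: "N \<ge> 1" and J': "set_mset J' \<subseteq> perms (N - 1)"
    and I': "arises_from N J' I'" and A: "maximal_antichain N A"
  shows "size (filter_mset (wins N A) I') = size J'"
proof -
  let ?J = "append_top N J'"
  have iff: "perm_prefix p i \<in> A \<longleftrightarrow> wins N A q"
    if x: "(p, i) \<in># marked_perms ?J" and q: "q \<in> perms N"
      and pre: "perm_prefix q i = perm_prefix p i" and top: "q ! (i - 1) = N" for p i q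
  proof -
    have "p \<in> perms N" "i \<in> lr_max_positions p"
      using set_marked_perms[OF x] set_append_top[OF N J'] by (auto simp: leaves_def)
    then have i: "i \<in> {1..N}"
      using lr_max_positions_subset permsD(3) by blast
    have "j = i" if "j \<in> {1..N}" "q ! (j - 1) = N" for j
      by (rule top_position_unique[OF q that(1) i that(2) top])
    then show ?thesis
      unfolding wins_iff[OF A q] pre[symmetric] using i top by blast
  qed
  have "size (filter_mset (\<lambda>(p, i). perm_prefix p i \<in> A) (marked_perms ?J))
      = size (filter_mset (wins N A) I')"
  proof (rule rel_mset_size_filter[OF I'[unfolded arises_from_def]])
    fix x q
    assume x: "x \<in># marked_perms ?J" and R: "(case x of (p, i) \<Rightarrow> \<lambda>q. q \<in> perms N \<and>
      perm_prefix q i = perm_prefix p i \<and> q ! (i - 1) = N) q"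
    obtain p i where "x = (p, i)"
      by (cases x)
    then show "(case x of (p, i) \<Rightarrow> perm_prefix p i \<in> A) \<longleftrightarrow> wins N A q"
      using iff[of p i q] x R by simp
  qed
  also have "size (filter_mset (\<lambda>(p, i). perm_prefix p i \<in> A) (marked_perms ?J))
      = (\<Sum>p\<in>#?J. card {i \<in> lr_max_positions p. perm_prefix p i \<in> A})"
    by (simp add: size_filter_marked_perms)
  also have "\<dots> = (\<Sum>p\<in>#?J. 1)"
    using card_antichain_below_leaf[OF A N] set_append_top[OF N J']
    by (intro arg_cong[where f = sum_mset] image_mset_cong) auto
  also have "\<dots> = size J'"
    by (simp add: append_top_def)
  finally show ?thesis by simp
qed

section \<open>Win probabilities as ratios of counts\<close>

lemma win_prob_eq:
  "game N I \<Longrightarrow> win_prob N I A = size (filter_mset (wins N A) I) / size I"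
  by (simp add: game_def win_prob_def prob_pmf_of_multiset)

text \<open>Nonemptiness comes from the win count: the leaves already win \<open>size J'\<close>
  times.\<close>

lemma arises_from_game:
  assumes N: "N \<ge> 1" and J': "J' \<noteq> {#}" "set_mset J' \<subseteq> perms (N - 1)"
    and I': "arises_from N J' I'"
  shows "game N I'"
proof -
  have "size (filter_mset (wins N (leaves N)) I') = size J'"
    by (rule arises_from_win_count[OF N J'(2) I' maximal_antichain_leaves[OF N]])
  then have "I' \<noteq> {#}"
    using J'(1) by auto
  with arises_from_subset[OF I'] show ?thesis
    by (simp add: game_def)
qed

section \<open>Consequences of strategy-indifference\<close>

lemma indifferent_win_count:
  assumes "game N I" "strategy_indifferent N I" "maximal_antichain N A" "maximal_antichain N B"
  shows "size (filter_mset (wins N A) I) = size (filter_mset (wins N B) I)"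
proof -
  \<comment> \<open>Both probabilities have the nonzero denominator \<open>size I\<close>, which can
    be cancelled.\<close>
  have "win_prob N I A = win_prob N I B" "size I \<noteq> 0"
    using assms unfolding strategy_indifferent_def game_def by (blast, simp)
  then show ?thesis
    by (simp add: win_prob_eq[OF assms(1)])
qed

text \<open>The cut at \<open>p\<close> wins as often as the set of all leaves. The leaves not above
  \<open>p\<close> contribute equally to both counts and cancel, which leaves \<open>w p\<close>
  against the leaves above \<open>p\<close>.\<close>

lemma indifferent_hits:
  assumes N: "N \<ge> 1" and I: "game N I" "strategy_indifferent N I" and p: "p \<in> prefix_tree N"
  shows "size (filter_mset (hits N p) I) =
    size (filter_mset (\<lambda>q. contains q p) (filter_mset (\<lambda>q. q \<in> leaves N) I))"
proof -
  have sub: "set_mset I \<subseteq> perms N"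
    using I(1) by (simp add: game_def)
  let ?C = "insert p {l \<in> leaves N. \<not> contains l p}"
  have "size (filter_mset (hits N p) I) + size (filter_mset (\<lambda>q. q \<in> leaves N \<and> \<not> contains q p) I)
      = size (filter_mset (\<lambda>q. hits N p q \<or> q \<in> leaves N \<and> \<not> contains q p) I)"
    by (subst size_filter_mset_disj) (auto simp: hits_def)
  also have "\<dots> = size (filter_mset (wins N ?C) I)"
    using wins_cut_iff[OF N p] sub by (intro arg_cong[where f = size] filter_mset_cong) auto
  also have "\<dots> = size (filter_mset (wins N (leaves N)) I)"
    by (intro indifferent_win_count I maximal_antichain_cut maximal_antichain_leaves N p)
  also have "\<dots> = size (filter_mset (\<lambda>q. q \<in> leaves N) I)"
    using wins_leaves_iff[OF N] sub by (intro arg_cong[where f = size] filter_mset_cong) auto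
  also have "\<dots> = size (filter_mset (\<lambda>q. (q \<in> leaves N \<and> contains q p) \<or>
      (q \<in> leaves N \<and> \<not> contains q p)) I)"
    by (intro arg_cong[where f = size] filter_mset_cong) auto
  also have "\<dots> = size (filter_mset (\<lambda>q. q \<in> leaves N \<and> contains q p) I) +
      size (filter_mset (\<lambda>q. q \<in> leaves N \<and> \<not> contains q p) I)"
    by (rule size_filter_mset_disj) auto
  finally show ?thesis
    by (simp add: filter_filter_mset conj_commute)
qed

text \<open>Every permutation is hit by exactly one prefix, so the weights \<open>w p\<close> sum to
  \<open>size I\<close>. Expressing each weight through leaves and swapping the summation counts the
  prefixes of each leaf instead.\<close>

lemma indifferent_size:
  assumes N: "N \<ge> 1" and I: "game N I" "strategy_indifferent N I"
  shows "size I = (\<Sum>q\<in>#filter_mset (\<lambda>q. q \<in> leaves N) I. card (lr_max_positions q))"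
proof -
  let ?J = "filter_mset (\<lambda>q. q \<in> leaves N) I"
  have sub: "set_mset I \<subseteq> perms N"
    using I(1) by (simp add: game_def)
  have "size I = (\<Sum>q\<in>#I. 1)"
    by simp
  also have "\<dots> = (\<Sum>q\<in>#I. card {p \<in> prefix_tree N. hits N p q})"
    using card_hits[OF N] sub by (intro arg_cong[where f = sum_mset] image_mset_cong) auto
  also have "\<dots> = (\<Sum>p\<in>prefix_tree N. size (filter_mset (hits N p) I))"
    by (rule sum_mset_card_swap[OF finite_prefix_tree])
  also have "\<dots> = (\<Sum>p\<in>prefix_tree N. size (filter_mset (\<lambda>q. contains q p) ?J))"
    by (intro sum.cong refl indifferent_hits N I)
  also have "\<dots> = (\<Sum>q\<in>#?J. card {p \<in> prefix_tree N. contains q p})"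
    by (rule sum_mset_card_swap[OF finite_prefix_tree, symmetric])
  also have "\<dots> = (\<Sum>q\<in>#?J. card (lr_max_positions q))"
    using card_contained sub by (intro arg_cong[where f = sum_mset] image_mset_cong) auto
  finally show ?thesis .
qed

lemma indifferent_equivalent:
  assumes N: "N \<ge> 1" and I: "game N I" "strategy_indifferent N I"
  shows "\<exists>J' I'. J' \<noteq> {#} \<and> set_mset J' \<subseteq> perms (N - 1) \<and> arises_from N J' I' \<and>
    game N I' \<and> strategically_equivalent N I I'"
proof -
  define J where "J = filter_mset (\<lambda>q. q \<in> leaves N) I"
  \<comment> \<open>The top entry that \<open>append_top\<close> will restore is removed from the
    leaves occurring in \<open>I\<close>.\<close>
  define J' where "J' = image_mset butlast J"
  have J: "q \<in> (\<lambda>p. p @ [N]) ` perms (N - 1)" if "q \<in># J" for q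
    using that by (simp add: J_def leaves_conv_append[OF N])
  then have J'_sub: "set_mset J' \<subseteq> perms (N - 1)"
    by (auto simp: J'_def dest!: J)
  have "append_top N J' = image_mset (\<lambda>q. butlast q @ [N]) J"
    by (simp add: append_top_def J'_def multiset.map_comp comp_def)
  also have "\<dots> = image_mset (\<lambda>q. q) J"
    by (intro image_mset_cong) (auto dest!: J)
  finally have app: "append_top N J' = J" by simp
  have size_I: "size I = (\<Sum>q\<in>#J. card (lr_max_positions q))"
    unfolding J_def by (rule indifferent_size[OF N I])
  \<comment> \<open>Without leaves the sum would be empty, while \<open>size I\<close> is
    positive.\<close>
  have "J \<noteq> {#}"
    using size_I I(1) by (auto simp: game_def)
  then have J'_ne: "J' \<noteq> {#}"
    by (simp add: J'_def)
  obtain I' where I': "arises_from N J' I'"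
    using arises_from_exists[OF N J'_sub] by blast
  have game: "game N I'"
    by (rule arises_from_game[OF N J'_ne J'_sub I'])
  have size: "size I' = size I"
    using arises_from_size[OF I'] size_I app by simp
  have "size (filter_mset (wins N A) I) = size (filter_mset (wins N A) I')"
    if A: "maximal_antichain N A" for A
  proof -
    \<comment> \<open>By indifference \<open>A\<close> may be replaced by the set of leaves, which
      wins on exactly the members of \<open>J\<close>. With equal sizes, equal counts give equal
      probabilities.\<close>
    have "size (filter_mset (wins N A) I) = size (filter_mset (wins N (leaves N)) I)"
      by (intro indifferent_win_count I A maximal_antichain_leaves N)
    also have "filter_mset (wins N (leaves N)) I = J"
      unfolding J_def using wins_leaves_iff[OF N] I(1)
      by (intro filter_mset_cong) (auto simp: game_def)
    also have "size J = size J'"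
      by (simp add: J'_def)
    also have "\<dots> = size (filter_mset (wins N A) I')"
      by (rule arises_from_win_count[OF N J'_sub I' A, symmetric])
    finally show ?thesis .
  qed
  then have "strategically_equivalent N I I'"
    by (simp add: strategically_equivalent_def win_prob_eq[OF I(1)] win_prob_eq[OF game] size)
  with J'_ne J'_sub I' game show ?thesis
    by blast
qed

lemma arises_from_indifferent:
  assumes N: "N \<ge> 1" and J': "J' \<noteq> {#}" "set_mset J' \<subseteq> perms (N - 1)"
    and I': "arises_from N J' I'"
  shows "strategy_indifferent N I'"
  by (simp add: strategy_indifferent_def win_prob_eq[OF arises_from_game[OF assms]]
      arises_from_win_count[OF N J'(2) I'])

text \<open>In the converse, the existence of \<open>I'\<close> is stated separately, so that the
  claim about every choice of new permutations is not vacuous. For \<open>N = 1\<close>,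
  \<open>perms 0\<close> contains just the empty list.\<close>

theorem corollary2p5:
  fixes N :: nat
  assumes "N \<ge> 1"
  shows "(\<forall>I. game N I \<and> strategy_indifferent N I \<longrightarrow>
            (\<exists>J' I'. J' \<noteq> {#} \<and> set_mset J' \<subseteq> perms (N - 1) \<and> arises_from N J' I' \<and>
               game N I' \<and> strategically_equivalent N I I')) \<and>
         (\<forall>J'. J' \<noteq> {#} \<and> set_mset J' \<subseteq> perms (N - 1) \<longrightarrow>
            (\<exists>I'. arises_from N J' I') \<and>
            (\<forall>I'. arises_from N J' I' \<longrightarrow> game N I' \<and> strategy_indifferent N I'))"
proof (intro conjI allI impI)
  fix I assume "game N I \<and> strategy_indifferent N I"
  then show "\<exists>J' I'. J' \<noteq> {#} \<and> set_mset J' \<subseteq> perms (N - 1) \<and> arises_from N J' I' \<and>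
      game N I' \<and> strategically_equivalent N I I'"
    by (elim conjE) (rule indifferent_equivalent[OF assms])
next
  fix J' assume J': "J' \<noteq> {#} \<and> set_mset J' \<subseteq> perms (N - 1)"
  show "\<exists>I'. arises_from N J' I'"
    using J' by (intro arises_from_exists[OF assms]) simp
  fix I' assume I': "arises_from N J' I'"
  show "game N I'"
    using J' by (intro arises_from_game[OF assms _ _ I']) simp_all
  show "strategy_indifferent N I'"
    using J' by (intro arises_from_indifferent[OF assms _ _ I']) simp_all
qed

end
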